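(* Let $n$ be a positive integer and let $S,T$ be nonempty subsets of $[n-1]=\{1,\ldots,n-1\}$. Suppose there are integers $s\in S$ and $t\in T$ with $s+t\le n$ and $\gcd(s,t)=1$. Then $T_n\langle S;T\rangle$ is a walk-ensured Toeplitz matrix.
   Context: Matrices are Boolean ($0,1$ entries with $1+1=1$). For nonempty $S,T\subseteq[n-1]$, $T_n\langle S;T\rangle$ denotes the $n\times n$ $(0,1)$-matrix whose $(i,j)$-entry is $1$ if and only if $j-i\in S$ or $i-j\in T$. Its digraph $D(A)$ has vertex set $[n]=\{1,\ldots,n\}$ and an arc $(i,j)$ exactly when the $(i,j)$-entry is $1$. Let $s_1=\min S$ and $\gcd(S+T)=\gcd\{s+t: s\in S,t\in T\}$. The matrix $A=T_n\langle S;T\rangle$ is called walk-ensured if there is a positive integer $M$ such that for all vertices $u,v\in[n]$ and every integer $\ell\ge M$ with $v-u\equiv \ell s_1 \pmod{\gcd(S+T)}$, there is a directed walk from $u$ to $v$ of length $\ell$ in $D(A)$. *)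

theory Defs
  imports
    "Jordan_Normal_Form.Matrix"
    "Graph_Theory.Graph_Theory"
    "HOL-Number_Theory.Cong"
begin

text \<open>Boolean arithmetic on \<open>{0, 1}\<close>, in which \<open>1 + 1 = 1\<close>.\<close>

instantiation bool :: comm_semiring_1
begin

definition zero_bool :: bool where "0 = False"
definition one_bool :: bool where "1 = True"
definition plus_bool :: "bool \<Rightarrow> bool \<Rightarrow> bool" where "x + y = (x \<or> y)"
definition times_bool :: "bool \<Rightarrow> bool \<Rightarrow> bool" where "x * y = (x \<and> y)"

instance
  by standard (auto simp: zero_bool_def one_bool_def plus_bool_def times_bool_def)

end

text \<open>
  Matrix indices start at 0. The vertices of digraphs are numbered from 1, so the \<open>(i, j)\<close>-entry in
  the usual numbering is \<open>A $$ (i - 1, j - 1)\<close>; the difference \<open>j - i\<close> is unaffected by this shift.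
\<close>

definition toeplitz_ST :: "nat \<Rightarrow> nat set \<Rightarrow> nat set \<Rightarrow> bool mat" where
  "toeplitz_ST n S T =
     mat n n (\<lambda>(i, j). if int j - int i \<in> int ` S \<or> int i - int j \<in> int ` T then 1 else 0)"

definition toeplitz_mat :: "'a mat \<Rightarrow> bool" where
  "toeplitz_mat A \<longleftrightarrow> square_mat A \<and>
     (\<forall>i j. Suc i < dim_row A \<longrightarrow> Suc j < dim_col A \<longrightarrow> A $$ (Suc i, Suc j) = A $$ (i, j))"

definition digraph_of_mat :: "bool mat \<Rightarrow> nat pair_pre_digraph" where
  "digraph_of_mat A =
     \<lparr> pverts = {1..dim_row A},
       parcs = {(i, j). i \<in> {1..dim_row A} \<and> j \<in> {1..dim_row A} \<and> A $$ (i - 1, j - 1) = 1} \<rparr>"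

definition gcd_sumset :: "nat set \<Rightarrow> nat set \<Rightarrow> nat" where
  "gcd_sumset S T = Gcd {s + t | s t. s \<in> S \<and> t \<in> T}"

text \<open>
  \<open>walk_ensured n S T\<close> is a property of the matrix \<open>toeplitz_ST n S T\<close>, which determines \<open>S\<close> and \<open>T\<close>
  whenever these are subsets of \<open>{1..n - 1}\<close>. A walk is a list of arcs; its length is the number of
  arcs, and vertices and arcs may be repeated.
\<close>

definition walk_ensured :: "nat \<Rightarrow> nat set \<Rightarrow> nat set \<Rightarrow> bool" where
  "walk_ensured n S T \<longleftrightarrow>
     (\<exists>M>0. \<forall>u\<in>{1..n}. \<forall>v\<in>{1..n}. \<forall>l\<ge>M.
        [int v - int u = int l * int (Min S)] (mod int (gcd_sumset S T)) \<longrightarrow>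
        (\<exists>p. pre_digraph.awalk (with_proj (digraph_of_mat (toeplitz_ST n S T))) u p v \<and>
             length p = l))"

end

theory Submission
  imports Defs
begin

text \<open>
  Let \<open>m = s + t\<close>. On a window of \<open>m\<close> consecutive vertices the arcs \<open>+s\<close> and \<open>-t\<close> form a single
  cycle, since \<open>s\<close> is a unit modulo \<open>m\<close>. As neighbouring windows overlap, every sufficiently long
  length \<open>l\<close> with \<open>v - u \<equiv> l s\<close> modulo \<open>m\<close> is the length of a walk from \<open>u\<close> to \<open>v\<close>. Let \<open>g\<close> be the
  least modulus that can replace \<open>m\<close> here. Inserting \<open>k\<close> additional arcs with step \<open>e\<close> shifts the
  congruence by \<open>k (e - s)\<close>, so \<open>g\<close> may be replaced by \<open>gcd g (e - s)\<close>, and minimality gives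
  \<open>g dvd e - s\<close> for all steps \<open>e\<close>. Hence \<open>g\<close> divides all sums in \<open>S + T\<close>.
\<close>

section \<open>Walks of every large length with a prescribed offset\<close>

text \<open>If every arc had step \<open>a\<close> modulo \<open>g\<close>, the displacement after
  \<open>l\<close> arcs would be \<open>l * a\<close>. The offset \<open>c\<close> records the
  deviation caused by arcs with other steps.\<close>

definition eventually_walks :: "nat rel \<Rightarrow> int \<Rightarrow> int \<Rightarrow> int \<Rightarrow> nat \<Rightarrow> nat \<Rightarrow> bool" where
  "eventually_walks R a g c u v \<longleftrightarrow>
     (\<forall>\<^sub>F l in sequentially. [int v - int u = int l * a + c] (mod g) \<longrightarrow> (u, v) \<in> R ^^ l)"

text \<open>The fixed first leg has displacement \<open>x - u\<close> in place of
  \<open>b * a\<close>; the difference is charged to the offset.\<close>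

lemma eventually_walks_prepend:
  assumes "(u, x) \<in> R ^^ b" and "eventually_walks R a g c x w"
    and "[c' = c + (int x - int u) - int b * a] (mod g)"
  shows "eventually_walks R a g c' u w"
proof -
  obtain L where L: "\<And>l. l \<ge> L \<Longrightarrow> [int w - int x = int l * a + c] (mod g) \<Longrightarrow> (x, w) \<in> R ^^ l"
    using assms(2) by (auto simp: eventually_walks_def eventually_sequentially)
  have "(u, w) \<in> R ^^ l"
    if "l \<ge> L + b" and l: "[int w - int u = int l * a + c'] (mod g)" for l
  proof -
    have "g dvd (int w - int u - (int l * a + c')) + (c' - (c + (int x - int u) - int b * a))"
      using l assms(3) by (intro dvd_add) (simp_all add: cong_iff_dvd_diff)
    moreover have "int (l - b) = int l - int b"
      using that(1) by simp
    ultimately have "[int w - int x = int (l - b) * a + c] (mod g)"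
      by (simp add: cong_iff_dvd_diff algebra_simps)
    then have "(x, w) \<in> R ^^ (l - b)"
      using that(1) by (intro L) auto
    then have "(u, w) \<in> R ^^ (b + (l - b))"
      using assms(1) by (auto simp: relpow_add)
    then show ?thesis
      using that(1) by simp
  qed
  then show ?thesis
    unfolding eventually_walks_def eventually_sequentially by blast
qed

lemma eventually_walks_witness:
  assumes "coprime a g" and "g > 0" and "eventually_walks R a g c u x"
  obtains b where "[int x - int u = int b * a + c] (mod g)" and "(u, x) \<in> R ^^ b"
proof -
  obtain L where L: "\<And>l. l \<ge> L \<Longrightarrow> [int x - int u = int l * a + c] (mod g) \<Longrightarrow> (u, x) \<in> R ^^ l"
    using assms(3) by (auto simp: eventually_walks_def eventually_sequentially)
  obtain i where i: "[a * i = 1] (mod g)"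
    using cong_solve_coprime_int assms(1) by blast
  \<comment> \<open>The first summand solves \<open>b * a \<equiv> x - u - c\<close> modulo
    \<open>g\<close>; the multiple of \<open>g\<close> keeps the residue and pushes \<open>b\<close>
    past the threshold \<open>L\<close>.\<close>
  define b where "b = nat ((i * (int x - int u - c)) mod g) + L * nat g"
  have b_int: "int b = (i * (int x - int u - c)) mod g + int L * g"
    using assms(2) by (simp add: b_def)
  have "[int b = i * (int x - int u - c)] (mod g)"
    unfolding b_int by (simp add: cong_def)
  then have "[int b * a = i * (int x - int u - c) * a] (mod g)"
    by (rule cong_mult) simp
  also have "i * (int x - int u - c) * a = (a * i) * (int x - int u - c)"
    by (simp add: algebra_simps)
  also have "[\<dots> = 1 * (int x - int u - c)] (mod g)"
    using i by (rule cong_mult) simp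
  finally have *: "[int x - int u = int b * a + c] (mod g)"
    by (simp add: cong_iff_dvd_diff dvd_diff_commute algebra_simps)
  have "L * 1 \<le> L * nat g"
    using assms(2) by (intro mult_le_mono) auto
  then have "b \<ge> L"
    unfolding b_def by linarith
  then show thesis
    using that * L by blast
qed

text \<open>One length \<open>b\<close> is fixed for the leg to \<open>x\<close>, and the leg to
  \<open>v\<close> absorbs all remaining length. Offsets add because the first leg deviates by
  \<open>x - u - b * a \<equiv> c\<close> modulo \<open>g\<close>.\<close>

lemma eventually_walks_trans:
  assumes "coprime a g" and "g > 0"
    and "eventually_walks R a g c u x" and "eventually_walks R a g c' x v"
  shows "eventually_walks R a g (c + c') u v"
proof -
  obtain b where b: "[int x - int u = int b * a + c] (mod g)" and walk: "(u, x) \<in> R ^^ b"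
    using eventually_walks_witness assms(1,2,3) .
  have "[c + c' = c' + (int x - int u) - int b * a] (mod g)"
    using b by (simp add: cong_iff_dvd_diff dvd_diff_commute algebra_simps)
  then show ?thesis
    using eventually_walks_prepend walk assms(4) by blast
qed

section \<open>Reducing the modulus\<close>

definition eventually_all_walks :: "nat rel \<Rightarrow> nat set \<Rightarrow> int \<Rightarrow> int \<Rightarrow> bool" where
  "eventually_all_walks R V a g \<longleftrightarrow> (\<forall>u\<in>V. \<forall>v\<in>V. eventually_walks R a g 0 u v)"

text \<open>Each round travels to \<open>x\<close> with offset 0, takes the arc to \<open>y\<close>
  and starts anew there, so it adds \<open>y - x - a\<close> to the offset.\<close>

lemma eventually_all_walks_insert_arcs:
  assumes "coprime a g" and "g > 0" and all: "eventually_all_walks R V a g"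
    and "x \<in> V" and "y \<in> V" and "(x, y) \<in> R" and "u \<in> V" and "v \<in> V"
  shows "eventually_walks R a g (int k * (int y - int x - a)) u v"
  using \<open>u \<in> V\<close>
proof (induction k arbitrary: u)
  case 0
  then show ?case
    using all \<open>v \<in> V\<close> by (simp add: eventually_all_walks_def)
next
  case (Suc k)
  have "eventually_walks R a g (int (Suc k) * (int y - int x - a)) x v"
  proof (rule eventually_walks_prepend[OF _ Suc.IH[OF \<open>y \<in> V\<close>]])
    show "(x, y) \<in> R ^^ 1"
      using \<open>(x, y) \<in> R\<close> by simp
    have "int (Suc k) * (int y - int x - a) =
        int k * (int y - int x - a) + (int y - int x) - int 1 * a"
      by (simp add: algebra_simps)
    then show "[int (Suc k) * (int y - int x - a) =
        int k * (int y - int x - a) + (int y - int x) - int 1 * a] (mod g)"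
      by (simp only: cong_refl)
  qed
  moreover have "eventually_walks R a g 0 u x"
    using all Suc.prems \<open>x \<in> V\<close> by (simp add: eventually_all_walks_def)
  ultimately show ?case
    using eventually_walks_trans[OF assms(1,2)] by (metis add_0)
qed

text \<open>Varying the number \<open>k\<close> of inserted arcs realises all offsets
  \<open>k * e\<close>, and modulo \<open>g\<close> these are exactly the multiples of
  \<open>gcd g e\<close>.\<close>

lemma eventually_all_walks_gcd:
  assumes "coprime a g" and "g > 0" and "eventually_all_walks R V a g"
    and "x \<in> V" and "y \<in> V" and "(x, y) \<in> R"
  shows "eventually_all_walks R V a (gcd g (int y - int x - a))"
proof -
  define e where "e = int y - int x - a"
  have "eventually_walks R a (gcd g e) 0 u v" if "u \<in> V" "v \<in> V" for u v
  proof -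
    \<comment> \<open>The offset \<open>k * e\<close> depends on \<open>k\<close> only modulo
      \<open>g\<close>, so the thresholds of finitely many \<open>k\<close> merge into one.\<close>
    have "\<forall>\<^sub>F l in sequentially. \<forall>k\<in>{..<nat g}.
        [int v - int u = int l * a + int k * e] (mod g) \<longrightarrow> (u, v) \<in> R ^^ l"
      using eventually_all_walks_insert_arcs[OF assms that] unfolding eventually_walks_def e_def
      by (intro eventually_ball_finite) auto
    then show ?thesis
      unfolding eventually_walks_def
    proof (rule eventually_mono, intro impI)
      fix l
      assume *: "\<forall>k\<in>{..<nat g}. [int v - int u = int l * a + int k * e] (mod g) \<longrightarrow> (u, v) \<in> R ^^ l"
        and "[int v - int u = int l * a + 0] (mod gcd g e)"
      then obtain q where q: "int v - int u - int l * a = gcd g e * q"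
        by (auto simp: cong_iff_dvd_diff elim: dvdE)
      obtain i j where ij: "i * g + j * e = gcd g e"
        using bezout_int by blast
      \<comment> \<open>By Bezout, \<open>j * q * e\<close> is congruent modulo \<open>g\<close> to
        \<open>gcd g e * q\<close>, the offset still missing; reduction modulo \<open>g\<close>
        brings the factor \<open>j * q\<close> into the range of \<open>k\<close>.\<close>
      define k where "k = nat ((j * q) mod g)"
      have k: "int k = (j * q) mod g"
        using \<open>g > 0\<close> by (simp add: k_def)
      have "[int l * a + int k * e = int l * a + j * q * e] (mod g)"
        unfolding k by (intro cong_add cong_mult) (auto simp: cong_def)
      also have "[int l * a + j * q * e = int v - int u] (mod g)"
      proof -
        have "int v - int u - (int l * a + j * q * e) = g * (i * q)"
          using q ij[symmetric] by (simp add: algebra_simps)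
        then show ?thesis
          by (metis cong_iff_dvd_diff cong_sym dvd_triv_left)
      qed
      finally have "[int v - int u = int l * a + int k * e] (mod g)"
        by (rule cong_sym)
      moreover have "k \<in> {..<nat g}"
        using \<open>g > 0\<close> by (simp add: k_def nat_less_iff)
      ultimately show "(u, v) \<in> R ^^ l"
        using * by blast
    qed
  qed
  then show ?thesis
    by (simp add: eventually_all_walks_def e_def)
qed

lemma eventually_all_walks_least_modulus:
  assumes "coprime a g" and "g > 0" and "eventually_all_walks R V a g"
  obtains g' where "g' > 0" and "eventually_all_walks R V a g'"
    and "\<And>x y. x \<in> V \<Longrightarrow> y \<in> V \<Longrightarrow> (x, y) \<in> R \<Longrightarrow> g' dvd int y - int x - a"
proof -
  \<comment> \<open>Coprimality belongs to \<open>P\<close> because every reduction of the modulus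
    requires it; it passes to divisors of the modulus.\<close>
  define P where "P h \<longleftrightarrow> h > 0 \<and> coprime a (int h) \<and> eventually_all_walks R V a (int h)" for h
  define h where "h = (LEAST h. P h)"
  have "P (nat g)"
    using assms by (simp add: P_def)
  then have P: "P h"
    unfolding h_def by (rule LeastI)
  have "int h dvd int y - int x - a" if "x \<in> V" "y \<in> V" "(x, y) \<in> R" for x y
  proof -
    let ?k = "gcd (int h) (int y - int x - a)"
    have "eventually_all_walks R V a ?k"
      using P that by (intro eventually_all_walks_gcd) (auto simp: P_def)
    moreover have "coprime a ?k"
      using P by (auto simp: P_def intro: coprime_divisors[OF dvd_refl gcd_dvd1])
    ultimately have "P (nat ?k)"
      using P by (simp add: P_def)
    then have "h \<le> nat ?k"
      unfolding h_def by (rule Least_le)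
    then have "int h \<le> ?k"
      by (simp add: le_nat_iff)
    moreover have "?k \<le> int h"
      using P by (intro zdvd_imp_le) (auto simp: P_def)
    ultimately have "?k = int h"
      by (rule antisym[rotated])
    then show ?thesis
      by (metis gcd_dvd2)
  qed
  then show thesis
    using that[of "int h"] P by (simp add: P_def)
qed

section \<open>Windows of \<open>s + t\<close> consecutive vertices\<close>

definition step_arcs :: "nat \<Rightarrow> int set \<Rightarrow> nat rel" where
  "step_arcs n D = {(u, v). u \<in> {1..n} \<and> v \<in> {1..n} \<and> int v - int u \<in> D}"

text \<open>From each vertex at least one of the steps \<open>s\<close> and \<open>- t\<close> stays
  in the window, and both are congruent to \<open>s\<close> modulo \<open>s + t\<close>. After
  \<open>l\<close> steps the residue determines the vertex, since the window contains each residue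
  once.\<close>

lemma step_arcs_window:
  assumes "int s \<in> D" and "- int t \<in> D" and "k + (s + t) \<le> n"
    and "u \<in> {k + 1..k + (s + t)}" and "v \<in> {k + 1..k + (s + t)}"
    and "[int v - int u = int l * int s] (mod int (s + t))"
  shows "(u, v) \<in> step_arcs n D ^^ l"
  using assms(4,6)
proof (induction l arbitrary: u)
  case 0
  have "[int v - int (k + 1) = int u - int (k + 1)] (mod int (s + t))"
    using 0(2) by (simp add: cong_iff_dvd_diff)
  then have "int v - int (k + 1) = int u - int (k + 1)"
    using 0(1) assms(5) by (intro cong_less_imp_eq_int[of _ "int (s + t)"]) auto
  then show ?case
    by simp
next
  case (Suc l)
  show ?case
  proof (cases "u + s \<le> k + (s + t)")
    case True
    have "(u + s, v) \<in> step_arcs n D ^^ l"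
      using Suc.prems True by (intro Suc.IH) (auto simp: cong_iff_dvd_diff algebra_simps)
    moreover have "(u, u + s) \<in> step_arcs n D"
      using Suc.prems(1) True assms(1,3) by (auto simp: step_arcs_def)
    ultimately show ?thesis
      by (rule relpow_Suc_I2[rotated])
  next
    case False
    \<comment> \<open>The step \<open>- t\<close> equals \<open>s - (s + t)\<close>; the added
      modulus accounts for this wrap-around.\<close>
    have "int (s + t) dvd int v - int u - int (Suc l) * int s + int (s + t)"
      using Suc.prems(2) by (intro dvd_add) (simp_all add: cong_iff_dvd_diff)
    moreover have "int (u - t) = int u - int t"
      using False by simp
    ultimately have "(u - t, v) \<in> step_arcs n D ^^ l"
      using Suc.prems(1) False by (intro Suc.IH) (auto simp: cong_iff_dvd_diff algebra_simps)
    moreover have "(u, u - t) \<in> step_arcs n D"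
      using Suc.prems(1) False assms(2,3) by (auto simp: step_arcs_def)
    ultimately show ?thesis
      by (rule relpow_Suc_I2[rotated])
  qed
qed

lemma eventually_all_walks_step_arcs:
  assumes "int s \<in> D" and "- int t \<in> D" and "s + t \<le> n" and "s > 0" and "t > 0"
    and "coprime s t"
  shows "eventually_all_walks (step_arcs n D) {1..n} (int s) (int (s + t))"
proof -
  let ?ev = "eventually_walks (step_arcs n D) (int s) (int (s + t)) 0"
  have window: "?ev u v"
    if "k + (s + t) \<le> n" "u \<in> {k + 1..k + (s + t)}" "v \<in> {k + 1..k + (s + t)}" for u v k
    using step_arcs_window[OF assms(1,2) that] by (simp add: eventually_walks_def)
  \<comment> \<open>Adjacent vertices share a window, as \<open>s + t \<ge> 2\<close>: either the
    initial one or the one ending at the larger vertex. Chaining them by \<open>trans\<close> keeps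
    the offset 0.\<close>
  have adjacent: "?ev u v" if "u \<in> {1..n}" "v \<in> {1..n}" "u \<le> v + 1" "v \<le> u + 1" for u v
  proof (cases "max u v \<le> s + t")
    case True
    then show ?thesis
      using that assms(3) by (intro window[of 0]) auto
  next
    case False
    then show ?thesis
      using that assms(4,5) by (intro window[of "max u v - (s + t)"]) auto
  qed
  have "coprime (int s) (int (s + t))"
    using assms(6) unfolding coprime_int_iff by (simp add: coprime_iff_gcd_eq_1)
  then have trans: "?ev u w" if "?ev u v" "?ev v w" for u v w
    using eventually_walks_trans[OF _ _ that] assms(4) by simp
  have "?ev u (u + i) \<and> ?ev (u + i) u" if "u \<ge> 1" "u + i \<le> n" for u i
    using that(2)
  proof (induction i)
    case 0
    then show ?case
      using that(1) adjacent[of u u] by simp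
  next
    case (Suc i)
    have "?ev (u + i) (u + Suc i)" and "?ev (u + Suc i) (u + i)"
      by (rule adjacent; use that(1) Suc.prems in simp)+
    moreover have "?ev u (u + i)" and "?ev (u + i) u"
      using Suc by (metis Suc_leD add_Suc_right)+
    ultimately show ?case
      by (blast intro: trans)
  qed
  then have "?ev u v" if "u \<in> {1..n}" "v \<in> {1..n}" for u v
    using that by (metis atLeastAtMost_iff le_add_diff_inverse linear)
  then show ?thesis
    by (simp add: eventually_all_walks_def)
qed

section \<open>From relation powers to walks in the Toeplitz digraph\<close>

lemma awalk_of_relpow:
  assumes "(u, v) \<in> parcs G ^^ l" and "parcs G \<subseteq> pverts G \<times> pverts G" and "u \<in> pverts G"
  shows "\<exists>p. pre_digraph.awalk (with_proj G) u p v \<and> length p = l"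
  using assms(1,3)
proof (induction l arbitrary: u)
  case 0
  then show ?case
    by (auto simp: pre_digraph.awalk_def pre_digraph.cas.simps)
next
  case (Suc l)
  from relpow_Suc_D2[OF Suc.prems(1)] obtain w where w: "(u, w) \<in> parcs G" "(w, v) \<in> parcs G ^^ l"
    by blast
  then obtain p where p: "pre_digraph.awalk (with_proj G) w p v" "length p = l"
    using Suc.IH assms(2) by blast
  have "pre_digraph.awalk (with_proj G) u ((u, w) # p) v"
    using p(1) w(1) Suc.prems(2) by (auto simp: pre_digraph.awalk_def pre_digraph.cas.simps)
  then show ?case
    using p(2) by (metis length_Cons)
qed

lemma pverts_digraph_toeplitz_ST: "pverts (digraph_of_mat (toeplitz_ST n S T)) = {1..n}"
  by (simp add: digraph_of_mat_def toeplitz_ST_def)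

lemma parcs_digraph_toeplitz_ST:
  "parcs (digraph_of_mat (toeplitz_ST n S T)) = step_arcs n (int ` S \<union> (\<lambda>t. - int t) ` T)"
  (is "?L = step_arcs n ?D")
proof (rule Set.set_eqI)
  fix a :: "nat \<times> nat"
  obtain i j where a: "a = (i, j)"
    by fastforce
  have "int i - int j \<in> int ` T \<longleftrightarrow> int j - int i \<in> (\<lambda>t. - int t) ` T"
    by (force simp: image_iff)
  \<comment> \<open>Vertices are at least 1, so lowering both by 1 to get matrix indices preserves
    their difference.\<close>
  then show "a \<in> ?L \<longleftrightarrow> a \<in> step_arcs n ?D"
    by (auto simp: a digraph_of_mat_def toeplitz_ST_def step_arcs_def one_bool_def zero_bool_def
        of_nat_diff)
qed

lemma toeplitz_mat_toeplitz_ST: "toeplitz_mat (toeplitz_ST n S T)"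
  by (simp add: toeplitz_mat_def toeplitz_ST_def)

lemma gcd_sumset_dvd: "s \<in> S \<Longrightarrow> t \<in> T \<Longrightarrow> gcd_sumset S T dvd s + t"
  unfolding gcd_sumset_def by (intro Gcd_dvd) blast

text \<open>Writing \<open>s - s'\<close> as \<open>(s + t) - (s' + t)\<close> shows the
  divisibility; this allows \<open>Min S\<close> to be exchanged for the chosen
  \<open>s\<close>.\<close>

lemma cong_gcd_sumset:
  assumes "s \<in> S" and "s' \<in> S" and "t \<in> T"
  shows "[int s = int s'] (mod int (gcd_sumset S T))"
proof -
  have "int (gcd_sumset S T) dvd int (s + t) - int (s' + t)"
    using assms by (intro dvd_diff) (simp_all only: int_dvd_int_iff gcd_sumset_dvd)
  then show ?thesis
    by (simp add: cong_iff_dvd_diff)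
qed

lemma walk_ensured_if_coprime:
  assumes S: "S \<subseteq> {1..n - 1}" and T: "T \<subseteq> {1..n - 1}"
    and st: "s \<in> S" "t \<in> T" "s + t \<le> n" "coprime s t"
  shows "walk_ensured n S T"
proof -
  define D where "D = int ` S \<union> (\<lambda>t. - int t) ` T"
  let ?R = "step_arcs n D" and ?d = "int (gcd_sumset S T)"
  have "s > 0" and "t > 0"
    using S T st by auto
  have "eventually_all_walks ?R {1..n} (int s) (int (s + t))"
    using st \<open>s > 0\<close> \<open>t > 0\<close> by (intro eventually_all_walks_step_arcs) (auto simp: D_def)
  moreover have "coprime (int s) (int (s + t))"
    using st(4) unfolding coprime_int_iff by (simp add: coprime_iff_gcd_eq_1)
  moreover have "int (s + t) > 0"
    using \<open>s > 0\<close> by simp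
  ultimately obtain g where g: "eventually_all_walks ?R {1..n} (int s) g"
    and g_dvd: "\<And>x y. x \<in> {1..n} \<Longrightarrow> y \<in> {1..n} \<Longrightarrow> (x, y) \<in> ?R \<Longrightarrow> g dvd int y - int x - int s"
    using eventually_all_walks_least_modulus by metis
  have "g dvd int (s' + t')" if "s' \<in> S" "t' \<in> T" for s' t'
  proof -
    have bounds: "s' \<in> {1..n - 1}" "t' \<in> {1..n - 1}"
      using that S T by auto
    \<comment> \<open>The arcs leaving and entering vertex 1 exist because \<open>s'\<close> and
      \<open>t'\<close> are at most \<open>n - 1\<close>. Subtracting their deviations cancels
      \<open>s\<close> and leaves \<open>s' + t'\<close>.\<close>
    then have "(1, 1 + s') \<in> ?R" "(1 + t', 1) \<in> ?R"
      using that by (auto simp: step_arcs_def D_def)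
    then have "g dvd (int (1 + s') - int 1 - int s) - (int 1 - int (1 + t') - int s)"
      using bounds by (intro dvd_diff g_dvd) (auto simp: step_arcs_def)
    then show ?thesis
      by simp
  qed
  then have "nat \<bar>g\<bar> dvd gcd_sumset S T"
    unfolding gcd_sumset_def by (intro Gcd_greatest) (auto simp: nat_abs_dvd_iff)
  then have g_dvd_d: "g dvd ?d"
    by (simp add: nat_abs_dvd_iff)
  \<comment> \<open>There are finitely many pairs of vertices, so one threshold serves all.\<close>
  have "\<forall>\<^sub>F l in sequentially. \<forall>u\<in>{1..n}. \<forall>v\<in>{1..n}.
      [int v - int u = int l * int s] (mod g) \<longrightarrow> (u, v) \<in> ?R ^^ l"
    using g unfolding eventually_all_walks_def eventually_walks_def
    by (intro eventually_ball_finite ballI) auto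
  then obtain M where M: "\<And>l u v. l \<ge> M \<Longrightarrow> u \<in> {1..n} \<Longrightarrow> v \<in> {1..n} \<Longrightarrow>
      [int v - int u = int l * int s] (mod g) \<Longrightarrow> (u, v) \<in> ?R ^^ l"
    unfolding eventually_sequentially by blast
  have "Min S \<in> S"
    using S st(1) by (intro Min_in) (auto intro: finite_subset)
  then have Min: "[int (Min S) = int s] (mod ?d)"
    using st by (intro cong_gcd_sumset)
  show ?thesis
    unfolding walk_ensured_def
  \<comment> \<open>The successor makes the bound positive.\<close>
  proof (intro exI[of _ "Suc M"] conjI ballI allI impI)
    fix u v l
    assume uv: "u \<in> {1..n}" "v \<in> {1..n}" and "Suc M \<le> l"
      and "[int v - int u = int l * int (Min S)] (mod ?d)"
    then have "[int v - int u = int l * int s] (mod g)"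
      using Min g_dvd_d by (meson cong_dvd_modulus cong_refl cong_mult cong_trans)
    then have "(u, v) \<in> ?R ^^ l"
      using M uv \<open>Suc M \<le> l\<close> by simp
    then show "\<exists>p. pre_digraph.awalk (with_proj (digraph_of_mat (toeplitz_ST n S T))) u p v \<and>
        length p = l"
      using uv by (intro awalk_of_relpow)
        (auto simp: parcs_digraph_toeplitz_ST pverts_digraph_toeplitz_ST D_def[symmetric] step_arcs_def)
  qed simp
qed

theorem theorem5p1:
  fixes n :: nat and S T :: "nat set"
  assumes "n > 0"
    and "S \<noteq> {}" and "S \<subseteq> {1..n - 1}"
    and "T \<noteq> {}" and "T \<subseteq> {1..n - 1}"
    and "\<exists>s\<in>S. \<exists>t\<in>T. s + t \<le> n \<and> gcd s t = 1"
  shows "toeplitz_mat (toeplitz_ST n S T) \<and> walk_ensured n S T"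
  using assms toeplitz_mat_toeplitz_ST walk_ensured_if_coprime coprime_iff_gcd_eq_1 by blast

end
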